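(* Let $\varepsilon>0$ and $\delta>0$, let $K\subset\mathbb{R}^n$ be the convex hull of a finite centrally symmetric set of points, and let $\mathbf{x}_1,\dots,\mathbf{x}_p$ be independent standard Gaussian vectors in $\mathbb{R}^n$. Define $$U_K=\{\mathbf{v}\in\operatorname{vert}(K)\mid\alpha_K(\mathbf{v})\ge\delta\},$$ and let $A_K$ be the event that $$\{\mathbf{x}_1,\dots,\mathbf{x}_p\}\cap\bigl(N_K(\mathbf{v})\cup N_K(-\mathbf{v})\bigr)\ne\varnothing\quad\text{for all }\mathbf{v}\in U_K.$$ Let $b$ be a real number with $$b\ge\max_{\mathbf{v}\in\operatorname{vert}(K)}\operatorname{diam}(\operatorname{base}_K(\mathbf{v})),$$ and set $$k=\left(\tfrac12\bigl(1-\sin(\arctan(b/\delta))\bigr)\right)^{\frac{n-1}{2}}.$$ If $$p>\frac{\log(|\operatorname{vert}(K)|/\varepsilon)}{\log(1/(1-k))},$$ then $\mathbb{P}[A_K]\ge 1-\varepsilon$.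
   Context: For a polytope $K\subset\mathbb{R}^n$: $\operatorname{vert}(K)$ is its set of vertices (extreme points). Two vertices are adjacent if there is an edge of $K$ connecting them. For $\mathbf{v}\in\operatorname{vert}(K)$: - the normal cone is $N_K(\mathbf{v})=\{\mathbf{x}\in\mathbb{R}^n\mid\langle\mathbf{x},\mathbf{z}-\mathbf{v}\rangle\le0\text{ for all }\mathbf{z}\in K\}$; - the simplicial constant is $\alpha_K(\mathbf{v})=\inf\{\|\mathbf{v}-\mathbf{x}\|_2\mid\mathbf{x}\in\operatorname{conv}(\operatorname{vert}(K)\setminus\{\mathbf{v}\})\}$; - the base is $\operatorname{base}_K(\mathbf{v})=\operatorname{conv}(\{\mathbf{x}\in\operatorname{vert}(K)\setminus\{\mathbf{v}\}\mid\mathbf{x}\text{ is adjacent to }\mathbf{v}\text{ in }K\})$. $\operatorname{conv}$ is the convex hull and $\operatorname{diam}$ the (Euclidean) diameter. Centrally symmetric means invariant under $\mathbf{x}\mapsto-\mathbf{x}$. *)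

theory Defs
  imports "HOL-Probability.Probability"
begin

definition centrally_symmetric :: "'a::uminus set \<Rightarrow> bool" where
  "centrally_symmetric S \<longleftrightarrow> uminus ` S = S"

definition vert :: "'a::euclidean_space set \<Rightarrow> 'a set" where
  "vert K = {v. v extreme_point_of K}"

definition adjacent :: "'a::euclidean_space set \<Rightarrow> 'a \<Rightarrow> 'a \<Rightarrow> bool" where
  "adjacent K v w \<longleftrightarrow> v \<in> vert K \<and> w \<in> vert K \<and> closed_segment v w edge_of K"

definition normal_cone :: "'a::euclidean_space set \<Rightarrow> 'a \<Rightarrow> 'a set" where
  "normal_cone K v = {x. \<forall>z\<in>K. x \<bullet> (z - v) \<le> 0}"

(* Valued in ereal so that the infimum over the empty set is infinity; this case
   arises when K is a single point. *)
definition simplicial_constant :: "'a::euclidean_space set \<Rightarrow> 'a \<Rightarrow> ereal" where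
  "simplicial_constant K v = (INF x\<in>convex hull (vert K - {v}). ereal (norm (v - x)))"

definition vertex_base :: "'a::euclidean_space set \<Rightarrow> 'a \<Rightarrow> 'a set" where
  "vertex_base K v = convex hull {x \<in> vert K - {v}. adjacent K x v}"

definition std_gaussian_density :: "real ^ 'n \<Rightarrow> real" where
  "std_gaussian_density x = (\<Prod>i\<in>UNIV. std_normal_density (x $ i))"

definition std_gaussian_vector :: "'w measure \<Rightarrow> ('w \<Rightarrow> real ^ 'n) \<Rightarrow> bool" where
  "std_gaussian_vector M X \<longleftrightarrow> distributed M lborel X (\<lambda>x. ennreal (std_gaussian_density x))"

end

theory Submission
  imports Defs
begin

text \<open>
  The heart of the matter is that for every vertex \<open>v\<close> with simplicial constant at least
  \<open>\<delta>\<close> a single Gaussian vector falls into \<open>N\<^sub>K(v) \<union> N\<^sub>K(-v)\<close> with probability at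
  least \<open>k\<close>. Independence then bounds the probability that all \<open>p\<close> vectors miss this set by
  \<open>(1 - k)^p\<close>, a union bound over the vertices gives \<open>|vert K| (1 - k)^p\<close>, and the
  hypothesis on \<open>p\<close> makes this at most \<open>\<epsilon>\<close>.

  The single-vector bound has a geometric and an analytic half, with \<open>\<tau> = b / \<delta>\<close> as the link.

  Geometry. A linear functional that does not increase along any edge at \<open>v\<close> is maximal over
  \<open>K\<close> at \<open>v\<close> (\<open>vertex_maximal_if_locally_maximal\<close>), so membership in the normal cone only has
  to be tested against the base of \<open>v\<close>. Let \<open>u\<close> be the unit vector pointing from the point of the
  base nearest to \<open>v\<close> towards \<open>v\<close>. Seen from \<open>v\<close>, the base lies at depth at least \<open>\<delta>\<close> in
  direction \<open>-u\<close> and within lateral distance \<open>b\<close> of the axis, hence in a circular cone whose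
  half-angle has tangent \<open>\<tau>\<close>; the normal cone contains the polar circular cone around \<open>u\<close>. By
  central symmetry \<open>N\<^sub>K(-v) = -N\<^sub>K(v)\<close>, so the union of the two normal cones contains a whole
  double cone \<open>\<tau> |x - (x \<bullet> u) u| \<le> |x \<bullet> u|\<close>.

  Analysis. The Gaussian measure of this double cone is estimated without polar coordinates.
  Integrals over the whole space can be compared by comparing integrals over all lines parallel to
  \<open>u\<close> (\<open>nn_integral_lborel_mono_on_lines\<close>). On the line through \<open>y \<bottom> u\<close> the double cone
  leaves a two-sided Gaussian tail \<open>|s| \<ge> \<tau> |y|\<close>, whose mass is at least
  \<open>exp (- \<tau>\<^sup>2 |y|\<^sup>2) / sqrt 2\<close> by Jensen's inequality
  (\<open>std_normal_two_sided_tail_lower_bound\<close>). Multiplied by the density at \<open>y\<close> this is again a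
  Gaussian in \<open>y\<close>, with quadratic form scaled by \<open>1 + 2 \<tau>\<^sup>2\<close>, so it equals the line integral of
  a rescaled isotropic Gaussian density on the whole space. The total mass of the latter is explicit
  and yields \<open>(1 + 2 \<tau>\<^sup>2) powr (- (n - 1) / 2) / sqrt 2\<close>, which for \<open>n \<ge> 2\<close> dominates
  \<open>k\<close>. For \<open>n = 1\<close> the double cone is everything and \<open>k = 1\<close>.
\<close>

section \<open>Edges and normal cones at a vertex of a polytope\<close>

lemma polytope_eq_convex_hull_vert:
  fixes K :: "'a::euclidean_space set"
  assumes "polytope K"
  shows "finite (vert K)" "K = convex hull (vert K)"
proof -
  show "finite (vert K)"
    using assms unfolding vert_def
    by (simp add: finite_polyhedron_extreme_points polytope_imp_polyhedron)
  show "K = convex hull (vert K)"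
    using Krein_Milman_Minkowski assms polytope_imp_compact polytope_imp_convex
    unfolding vert_def by blast
qed

text \<open>Every face of a polyhedron is exposed, in particular the face \<open>{v}\<close>.\<close>

lemma vert_strictly_exposed:
  fixes K :: "'a::euclidean_space set"
  assumes "polytope K" "v \<in> vert K"
  obtains a where "\<And>z. z \<in> K \<Longrightarrow> z \<noteq> v \<Longrightarrow> 0 < a \<bullet> (z - v)"
proof -
  have "{v} exposed_face_of K"
    using assms by (simp add: exposed_face_of_polyhedron polytope_imp_polyhedron face_of_singleton vert_def)
  then obtain a c where ac: "K \<subseteq> {x. a \<bullet> x \<le> c}" "{v} = K \<inter> {x. a \<bullet> x = c}"
    unfolding exposed_face_of_def by blast
  have "0 < (- a) \<bullet> (z - v)" if "z \<in> K" "z \<noteq> v" for z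
  proof -
    have "a \<bullet> v = c" "a \<bullet> z \<le> c" "a \<bullet> z \<noteq> c" using ac that by auto
    then show ?thesis by (simp add: inner_diff_right)
  qed
  then show thesis by (rule that)
qed

text \<open>
  The functional \<open>a\<close> measures height above \<open>v\<close>. Among the vertices other than \<open>v\<close> let \<open>r\<close> be
  the largest slope of \<open>d\<close> relative to \<open>a\<close>. Then \<open>d - r a\<close> attains its maximum over \<open>T\<close> at
  \<open>v\<close> and at some other vertex, and its level set is the required face. This serves twice: to
  find an edge along which a given functional increases fastest, and to cut down any face that has
  two different slopes.
\<close>

lemma steepest_face:
  fixes T :: "'a::euclidean_space set"
  assumes T: "polytope T" and v: "v \<in> vert T" "T \<noteq> {v}"
    and a: "\<And>z. z \<in> T \<Longrightarrow> z \<noteq> v \<Longrightarrow> 0 < a \<bullet> (z - v)"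
  obtains r T' where "T' face_of T" "v \<in> T'" "T' \<noteq> {v}"
    "\<And>z. z \<in> T \<Longrightarrow> d \<bullet> (z - v) \<le> r * (a \<bullet> (z - v))"
    "\<And>z. z \<in> T' \<Longrightarrow> d \<bullet> (z - v) = r * (a \<bullet> (z - v))"
proof -
  note hull = polytope_eq_convex_hull_vert[OF T]
  have sub: "vert T \<subseteq> T" by (auto simp: vert_def extreme_point_of_def)
  have ne: "vert T - {v} \<noteq> {}"
    using v hull(2) by (metis Diff_eq_empty_iff convex_hull_singleton subset_singletonD insert_iff empty_iff)
  define q where "q z = (d \<bullet> (z - v)) / (a \<bullet> (z - v))" for z
  define r where "r = Max (q ` (vert T - {v}))"
  define e where "e = d - r *\<^sub>R a"
  have "q z \<le> r" if "z \<in> vert T - {v}" for z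
    unfolding r_def using hull(1) that by simp
  then have "e \<bullet> z \<le> e \<bullet> v" if "z \<in> vert T" for z
    using that a[of z] sub
    by (cases "z = v") (force simp: q_def e_def divide_le_eq inner_diff_left inner_diff_right right_diff_distrib)+
  then have "vert T \<subseteq> {z. e \<bullet> z \<le> e \<bullet> v}" by blast
  then have le: "e \<bullet> z \<le> e \<bullet> v" if "z \<in> T" for z
    using that hull(2) hull_minimal[of "vert T" "{z. e \<bullet> z \<le> e \<bullet> v}" convex] convex_halfspace_le by blast
  have "r \<in> q ` (vert T - {v})"
    unfolding r_def using hull(1) ne by (intro Max_in) auto
  then obtain z0 where z0: "z0 \<in> vert T" "z0 \<noteq> v" "q z0 = r" by auto
  define T' where "T' = T \<inter> {z. e \<bullet> z = e \<bullet> v}"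
  have z0T: "z0 \<in> T'"
  proof -
    have "0 < a \<bullet> (z0 - v)" using z0 sub a by blast
    then have "d \<bullet> (z0 - v) = r * (a \<bullet> (z0 - v))" using z0(3) by (simp add: q_def divide_eq_eq)
    then show ?thesis
      using z0 sub by (auto simp: T'_def e_def inner_diff_left inner_diff_right right_diff_distrib)
  qed
  show thesis
  proof (rule that[of T' r])
    show "T' face_of T" unfolding T'_def
      using le T polytope_imp_convex by (intro face_of_Int_supporting_hyperplane_le) auto
    show "v \<in> T'" using v sub by (auto simp: T'_def)
    show "T' \<noteq> {v}" using z0T z0 by blast
    show "d \<bullet> (z - v) \<le> r * (a \<bullet> (z - v))" if "z \<in> T" for z
      using le[OF that] by (simp add: e_def inner_diff_left inner_diff_right right_diff_distrib)
    show "d \<bullet> (z - v) = r * (a \<bullet> (z - v))" if "z \<in> T'" for z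
      using that by (simp add: T'_def e_def inner_diff_left inner_diff_right right_diff_distrib)
  qed
qed

text \<open>
  An inclusion-minimal face among those that contain \<open>v\<close> and more is an edge. If it had two further
  vertices \<open>z\<close> and \<open>w\<close>, their directions from \<open>v\<close> would not be parallel, hence some functional
  would have different slopes towards them, and the face of steepest slope would be strictly smaller.
\<close>

lemma face_at_vertex_has_adjacent:
  fixes K :: "'a::euclidean_space set"
  assumes K: "polytope K" and v: "v \<in> vert K"
    and F: "F face_of K" "v \<in> F" "F \<noteq> {v}"
  obtains w where "w \<in> F" "w \<noteq> v" "adjacent K w v"
proof -
  define \<F> where "\<F> = {T. T face_of K \<and> v \<in> T \<and> T \<noteq> {v} \<and> T \<subseteq> F}"
  have "finite \<F>"
    using finite_polytope_faces[OF K] by (rule finite_subset[rotated]) (auto simp: \<F>_def)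
  moreover have "F \<in> \<F>" using F by (simp add: \<F>_def)
  ultimately obtain T where T: "T \<in> \<F>" and min: "\<And>T'. T' \<in> \<F> \<Longrightarrow> T' \<subseteq> T \<Longrightarrow> T = T'"
    using finite_has_minimal[of \<F>] by blast
  have TK: "T face_of K" "v \<in> T" "T \<noteq> {v}" "T \<subseteq> F" using T by (auto simp: \<F>_def)
  have pT: "polytope T" using TK(1) K face_of_polytope_polytope by blast
  have vT: "v \<in> vert T" using v TK by (simp add: vert_def extreme_point_of_face)
  note hull = polytope_eq_convex_hull_vert[OF pT]
  have sub: "vert T \<subseteq> T" by (auto simp: vert_def extreme_point_of_def)
  obtain a where a: "\<And>z. z \<in> T \<Longrightarrow> z \<noteq> v \<Longrightarrow> 0 < a \<bullet> (z - v)"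
    using vert_strictly_exposed[OF pT vT] by blast
  obtain w where w: "w \<in> vert T" "w \<noteq> v"
    using vT TK(3) hull(2) by (metis convex_hull_singleton subsetI subset_singletonD singletonD empty_iff insertI1)
  have only: "z = w" if z: "z \<in> vert T" "z \<noteq> v" for z
  proof (rule ccontr)
    assume "z \<noteq> w"
    have pos: "0 < a \<bullet> (z - v)" "0 < a \<bullet> (w - v)" using a z w sub by blast+
    \<comment> \<open>The multiple of \<open>a\<close> that agrees with \<open>d\<close> towards both \<open>z\<close> and \<open>w\<close> can
    only exist if \<open>d \<bullet> d = 0\<close>, that is, if the two directions are parallel.\<close>
    define d where "d = (a \<bullet> (w - v)) *\<^sub>R (z - v) - (a \<bullet> (z - v)) *\<^sub>R (w - v)"
    obtain r T' where T': "T' face_of T" "v \<in> T'" "T' \<noteq> {v}"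
        "\<And>z. z \<in> T' \<Longrightarrow> d \<bullet> (z - v) = r * (a \<bullet> (z - v))"
      using steepest_face[where d = d, OF pT vT TK(3) a] by metis
    have "T' \<in> \<F>"
      using T' TK face_of_trans face_of_imp_subset unfolding \<F>_def by blast
    then have "T' = T" using min T'(1) face_of_imp_subset by blast
    then have "d \<bullet> (z - v) = r * (a \<bullet> (z - v))" "d \<bullet> (w - v) = r * (a \<bullet> (w - v))"
      using T'(4) z w sub by blast+
    moreover have "d \<bullet> d = (a \<bullet> (w - v)) * (d \<bullet> (z - v)) - (a \<bullet> (z - v)) * (d \<bullet> (w - v))"
      by (subst (2) d_def) (simp only: inner_diff_right[of d] inner_scaleR_right)
    ultimately have "d \<bullet> d = 0" by simp
    then have par: "(a \<bullet> (w - v)) *\<^sub>R (z - v) = (a \<bullet> (z - v)) *\<^sub>R (w - v)"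
      by (simp add: d_def)
    \<comment> \<open>A vertex cannot lie strictly between \<open>v\<close> and another point of \<open>T\<close>.\<close>
    have nope: False
      if "x \<in> vert T" "y \<in> T" "x \<noteq> v" "x - v = t *\<^sub>R (y - v)" "0 < t" "t < 1" for x y t
    proof -
      have "x = (1 - t) *\<^sub>R v + t *\<^sub>R y" using that(4) by (simp add: algebra_simps)
      moreover have "v \<noteq> y" using that by auto
      ultimately have "x \<in> open_segment v y" using that by (auto simp: in_segment)
      then show False using that(1,2) \<open>v \<in> T\<close> by (auto simp: vert_def extreme_point_of_def)
    qed
    define t where "t = (a \<bullet> (z - v)) / (a \<bullet> (w - v))"
    have zt: "z - v = t *\<^sub>R (w - v)"
    proof -
      have "z - v = (1 / (a \<bullet> (w - v))) *\<^sub>R ((a \<bullet> (w - v)) *\<^sub>R (z - v))" using pos by simp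
      also have "\<dots> = t *\<^sub>R (w - v)" unfolding par by (simp add: t_def)
      finally show ?thesis .
    qed
    have "t > 0" using pos by (simp add: t_def)
    consider "t = 1" | "t < 1" | "t > 1" by linarith
    then show False
    proof cases
      case 1 then show False using zt \<open>z \<noteq> w\<close> by simp
    next
      case 2 then show False using nope[of z w t] z w sub zt \<open>t > 0\<close> by blast
    next
      case 3
      then have "w - v = (1 / t) *\<^sub>R (z - v)" using zt by simp
      then show False using nope[of w z "1 / t"] z w sub 3 by fastforce
    qed
  qed
  have "vert T = {w, v}" using only w vT by blast
  then have seg: "T = closed_segment w v" using hull(2) by (simp add: segment_convex_hull)
  have "aff_dim (closed_segment w v) = 1" using w by (simp add: segment_convex_hull aff_dim_convex_hull aff_dim_2)
  moreover have "w \<in> vert K" using w TK(1) by (simp add: vert_def extreme_point_of_face)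
  ultimately have "adjacent K w v" using seg TK v by (simp add: adjacent_def edge_of_def)
  then show thesis using that[of w] w sub TK by blast
qed

text \<open>
  The optimality criterion behind the simplex method. The face of steepest slope at \<open>v\<close> contains an
  edge, along which \<open>d\<close> has the largest slope \<open>r\<close> available in \<open>K\<close>; since \<open>d\<close> does not
  increase along edges, \<open>r \<le> 0\<close>.
\<close>

lemma vertex_maximal_if_locally_maximal:
  fixes K :: "'a::euclidean_space set"
  assumes K: "polytope K" and v: "v \<in> vert K"
    and loc: "\<And>w. adjacent K w v \<Longrightarrow> w \<noteq> v \<Longrightarrow> d \<bullet> (w - v) \<le> 0"
    and z: "z \<in> K"
  shows "d \<bullet> (z - v) \<le> 0"
proof (cases "K = {v}")
  case True then show ?thesis using z by simp
next
  case False
  obtain a where a: "\<And>z. z \<in> K \<Longrightarrow> z \<noteq> v \<Longrightarrow> 0 < a \<bullet> (z - v)"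
    using vert_strictly_exposed[OF K v] by blast
  obtain r T where T: "T face_of K" "v \<in> T" "T \<noteq> {v}"
    and le: "\<And>z. z \<in> K \<Longrightarrow> d \<bullet> (z - v) \<le> r * (a \<bullet> (z - v))"
    and eq: "\<And>z. z \<in> T \<Longrightarrow> d \<bullet> (z - v) = r * (a \<bullet> (z - v))"
    using steepest_face[where d = d, OF K v False a] by metis
  obtain w where w: "w \<in> T" "w \<noteq> v" "adjacent K w v"
    using face_at_vertex_has_adjacent[OF K v T] by blast
  have "0 < a \<bullet> (w - v)" using a w T face_of_imp_subset by blast
  moreover have "r * (a \<bullet> (w - v)) \<le> 0" using loc[of w] w eq[of w] by simp
  ultimately have "r \<le> 0" by (simp add: mult_le_0_iff)
  moreover have "0 \<le> a \<bullet> (z - v)" using a[OF z] by (cases "z = v") auto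
  ultimately show ?thesis using le[OF z] by (meson mult_nonpos_nonneg order_trans)
qed

text \<open>
  The parameter is the cotangent of the half-angle, so that either half is the polar, up to sign, of a
  circular cone whose half-angle has tangent \<open>\<tau>\<close>.
\<close>

definition double_cone :: "'a::euclidean_space \<Rightarrow> real \<Rightarrow> 'a set" where
  "double_cone u \<tau> = {x. \<tau> * norm (x - (x \<bullet> u) *\<^sub>R u) \<le> \<bar>x \<bullet> u\<bar>}"

text \<open>
  Let \<open>w\<close> be the point of the base nearest to \<open>v\<close> and \<open>u\<close> the direction of \<open>v - w\<close>. For a
  neighbour \<open>z\<close> of \<open>v\<close>, the displacement \<open>z - v\<close> has component at most \<open>-\<delta>\<close> along \<open>u\<close>,
  because the base lies beyond the hyperplane through \<open>w\<close> orthogonal to \<open>u\<close>, and its component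
  orthogonal to \<open>u\<close> is that of \<open>z - w\<close>, hence at most the diameter of the base. A vector whose
  lateral part is small compared with its part along \<open>u\<close> therefore has nonpositive inner product
  with all edges at \<open>v\<close>. If \<open>v\<close> has no neighbour, then \<open>K = {v}\<close> and any \<open>u\<close> will do.
\<close>

lemma circular_cone_subset_normal_cone:
  fixes K :: "'a::euclidean_space set"
  assumes K: "polytope K" and v: "v \<in> vert K"
    and \<delta>: "0 < \<delta>" "ereal \<delta> \<le> simplicial_constant K v"
    and b: "diameter (vertex_base K v) \<le> b"
  obtains u where "norm u = 1"
    "\<And>x. (b / \<delta>) * norm (x - (x \<bullet> u) *\<^sub>R u) \<le> x \<bullet> u \<Longrightarrow> x \<in> normal_cone K v"
proof (cases "vertex_base K v = {}")
  case True
  then have "\<And>w. adjacent K w v \<Longrightarrow> w \<noteq> v \<Longrightarrow> False"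
    by (auto simp: vertex_base_def adjacent_def)
  then have "x \<in> normal_cone K v" for x
    using vertex_maximal_if_locally_maximal[OF K v] unfolding normal_cone_def by blast
  moreover obtain u :: 'a where "norm u = 1" using vector_choose_size[of 1] by auto
  ultimately show thesis using that by blast
next
  case False
  let ?B = "vertex_base K v"
  have fin: "finite {x \<in> vert K - {v}. adjacent K x v}"
    using polytope_eq_convex_hull_vert(1)[OF K] by simp
  have cB: "compact ?B" "convex ?B"
    unfolding vertex_base_def using fin by (auto simp: finite_imp_compact_convex_hull)
  define w where "w = closest_point ?B v"
  have w: "w \<in> ?B" unfolding w_def using cB False compact_imp_closed closest_point_in_set by blast
  have obt: "(v - w) \<bullet> (y - w) \<le> 0" if "y \<in> ?B" for y
    unfolding w_def using closest_point_dot cB that compact_imp_closed by blast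
  have "w \<in> convex hull (vert K - {v})"
    using w hull_mono[of "{x \<in> vert K - {v}. adjacent K x v}" "vert K - {v}" convex]
    unfolding vertex_base_def by blast
  then have "simplicial_constant K v \<le> ereal (norm (v - w))"
    unfolding simplicial_constant_def by (rule INF_lower)
  then have dw: "\<delta> \<le> norm (v - w)" using \<delta>(2) by (meson ereal_less_eq(3) order_trans)
  define h where "h = norm (v - w)"
  have h: "h > 0" "\<delta> \<le> h" using dw \<delta> by (auto simp: h_def)
  define u where "u = (1 / h) *\<^sub>R (v - w)"
  have u: "norm u = 1" using h by (simp add: u_def h_def)
  have vw: "v - w = h *\<^sub>R u" using h by (simp add: u_def)
  have b0: "0 \<le> b" using b diameter_ge_0 cB compact_imp_bounded by (metis order_trans)
  have "x \<in> normal_cone K v" if x: "(b / \<delta>) * norm (x - (x \<bullet> u) *\<^sub>R u) \<le> x \<bullet> u" for x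
  proof -
    define t where "t = x \<bullet> u"
    define y where "y = x - t *\<^sub>R u"
    have uu: "u \<bullet> u = 1" using u by (simp add: norm_eq_1)
    have yu: "y \<bullet> u = 0" by (simp add: y_def t_def inner_diff_left uu)
    have ineq: "b * norm y \<le> \<delta> * t"
      using x \<delta>(1) by (simp add: y_def t_def field_simps)
    have t0: "0 \<le> t"
      using ineq b0 \<delta>(1) by (metis mult_nonneg_nonneg norm_ge_zero order_trans zero_le_mult_iff not_less)
    have "x \<bullet> (z - v) \<le> 0" if z: "adjacent K z v" "z \<noteq> v" for z
    proof -
      have zB: "z \<in> ?B" unfolding vertex_base_def
        using z by (intro hull_inc) (auto simp: adjacent_def)
      have zw: "norm (z - w) \<le> b"
        using diameter_bounded_bound[OF _ zB w] cB compact_imp_bounded b by (fastforce simp: dist_norm)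
      have "h * (u \<bullet> (z - w)) \<le> 0" using obt[OF zB] by (simp add: vw)
      then have uz: "u \<bullet> (z - w) \<le> 0" using h by (simp add: mult_le_0_iff)
      have e: "x = y + t *\<^sub>R u" by (simp add: y_def)
      have zv: "z - v = (z - w) - h *\<^sub>R u" using vw by (simp add: algebra_simps)
      have "x \<bullet> (z - v) = x \<bullet> (z - w) - h * t"
        unfolding zv by (simp only: inner_diff_right inner_scaleR_right t_def)
      also have "\<dots> = y \<bullet> (z - w) + t * (u \<bullet> (z - w)) - h * t"
        unfolding e by (simp only: inner_add_left inner_scaleR_left)
      also have "\<dots> \<le> norm y * norm (z - w) + 0 - \<delta> * t"
        using t0 uz h norm_cauchy_schwarz[of y "z - w"]
        by (intro diff_mono add_mono mult_right_mono) (auto simp: mult_nonneg_nonpos)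
      also have "\<dots> \<le> norm y * b - \<delta> * t"
        using zw by (simp add: mult_left_mono)
      also have "\<dots> \<le> 0" using ineq by (simp add: mult.commute)
      finally show ?thesis .
    qed
    then show ?thesis
      using vertex_maximal_if_locally_maximal[OF K v] unfolding normal_cone_def by blast
  qed
  then show thesis using that u by blast
qed

lemma normal_cone_uminus:
  assumes "centrally_symmetric K" "- x \<in> normal_cone K v"
  shows "x \<in> normal_cone K (- v)"
proof -
  have "x \<bullet> (z + v) \<le> 0" if "z \<in> K" for z
  proof -
    have "- z \<in> K" using that assms(1) unfolding centrally_symmetric_def by blast
    then have "(- x) \<bullet> (- z - v) \<le> 0" using assms(2) by (auto simp: normal_cone_def)
    then show ?thesis by (simp add: inner_simps)
  qed
  then show ?thesis by (auto simp: normal_cone_def)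
qed

lemma centrally_symmetric_convex_hull:
  fixes S :: "'a::euclidean_space set"
  assumes "centrally_symmetric S"
  shows "centrally_symmetric (convex hull S)"
  using assms convex_hull_scaling[of "-1" S] by (simp add: centrally_symmetric_def)

lemma double_cone_subset_normal_cones:
  fixes K :: "'a::euclidean_space set"
  assumes K: "polytope K" "centrally_symmetric K" and v: "v \<in> vert K"
    and \<delta>: "0 < \<delta>" "ereal \<delta> \<le> simplicial_constant K v"
    and b: "diameter (vertex_base K v) \<le> b"
  obtains u where "norm u = 1" "double_cone u (b / \<delta>) \<subseteq> normal_cone K v \<union> normal_cone K (- v)"
proof -
  obtain u where u: "norm u = 1"
    and cone: "\<And>x. (b / \<delta>) * norm (x - (x \<bullet> u) *\<^sub>R u) \<le> x \<bullet> u \<Longrightarrow> x \<in> normal_cone K v"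
    using circular_cone_subset_normal_cone[OF K(1) v \<delta> b] by metis
  have "x \<in> normal_cone K v \<union> normal_cone K (- v)" if "x \<in> double_cone u (b / \<delta>)" for x
  proof (cases "0 \<le> x \<bullet> u")
    case True
    then show ?thesis using that cone[of x] by (simp add: double_cone_def)
  next
    case False
    have "norm (- x - (- x \<bullet> u) *\<^sub>R u) = norm (x - (x \<bullet> u) *\<^sub>R u)"
      by (metis inner_minus_left minus_diff_eq minus_diff_minus norm_minus_cancel scaleR_minus_left)
    then have "- x \<in> normal_cone K v"
      using that False cone[of "- x"] by (simp add: double_cone_def)
    then show ?thesis using normal_cone_uminus K(2) by blast
  qed
  then show thesis using that u by blast
qed

section \<open>The Gaussian measure of a circular double cone\<close>

lemma nn_integral_lborel_shift:
  fixes f :: "'a::euclidean_space \<Rightarrow> ennreal"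
  assumes [measurable]: "f \<in> borel_measurable borel"
  shows "(\<integral>\<^sup>+x. f (x + c) \<partial>lborel) = (\<integral>\<^sup>+x. f x \<partial>lborel)"
proof -
  have "(\<integral>\<^sup>+x. f x \<partial>lborel) = (\<integral>\<^sup>+x. f x \<partial>distr lborel borel ((+) c))"
    by (simp add: lborel_distr_plus)
  also have "\<dots> = (\<integral>\<^sup>+x. f (x + c) \<partial>lborel)"
    by (subst nn_integral_distr) (auto simp: add.commute)
  finally show ?thesis by simp
qed

lemma nn_integral_lborel_scaleR:
  fixes f :: "'a::euclidean_space \<Rightarrow> ennreal"
  assumes [measurable]: "f \<in> borel_measurable borel" and c: "0 < c"
  shows "(\<integral>\<^sup>+x. f (c *\<^sub>R x) \<partial>lborel) = ennreal (1 / c ^ DIM('a)) * (\<integral>\<^sup>+x. f x \<partial>lborel)"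
proof -
  have "(\<integral>\<^sup>+x. f x \<partial>lborel) = ennreal (c ^ DIM('a)) * (\<integral>\<^sup>+x. f (c *\<^sub>R x) \<partial>lborel)"
    using c by (subst lborel_affine[of c 0])
      (simp_all add: nn_integral_density nn_integral_distr nn_integral_cmult)
  moreover have "ennreal (1 / c ^ DIM('a)) * ennreal (c ^ DIM('a)) = 1"
    using c by (simp add: ennreal_mult[symmetric])
  ultimately show ?thesis by (simp add: mult.assoc[symmetric])
qed

lemma nn_integral_std_normal_density: "(\<integral>\<^sup>+s. ennreal (std_normal_density s) \<partial>lborel) = 1"
  by (subst nn_integral_eq_integral) (auto simp: integral_normal_density)

text \<open>
  Fubini's theorem for the direction \<open>u\<close>, in a form that needs no choice of coordinates. Each line
  parallel to \<open>u\<close> would be counted once for each of its points; weighting the base point \<open>x\<close> by a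
  probability density of \<open>x \<bullet> u\<close> compensates for this.
\<close>

lemma nn_integral_lborel_along_lines:
  fixes f :: "'a::euclidean_space \<Rightarrow> ennreal" and u :: 'a
  assumes [measurable]: "f \<in> borel_measurable borel" and u: "norm u = 1"
  shows "(\<integral>\<^sup>+x. f x \<partial>lborel)
       = (\<integral>\<^sup>+x. std_normal_density (x \<bullet> u) * (\<integral>\<^sup>+s. f (x + s *\<^sub>R u) \<partial>lborel) \<partial>lborel)"
proof -
  have uu: "u \<bullet> u = 1" using u by (simp add: norm_eq_1)
  have "(\<integral>\<^sup>+x. std_normal_density (x \<bullet> u) * (\<integral>\<^sup>+s. f (x + s *\<^sub>R u) \<partial>lborel) \<partial>lborel)
      = (\<integral>\<^sup>+x. (\<integral>\<^sup>+s. std_normal_density (x \<bullet> u) * f (x + s *\<^sub>R u) \<partial>lborel) \<partial>lborel)"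
    by (simp add: nn_integral_cmult)
  also have "\<dots> = (\<integral>\<^sup>+s. (\<integral>\<^sup>+x. std_normal_density (x \<bullet> u) * f (x + s *\<^sub>R u) \<partial>lborel) \<partial>lborel)"
    by (rule lborel_pair.Fubini'[symmetric]) measurable
  also have "\<dots> = (\<integral>\<^sup>+s. (\<integral>\<^sup>+x. std_normal_density (x \<bullet> u - s) * f x \<partial>lborel) \<partial>lborel)"
  proof (rule nn_integral_cong)
    fix s :: real
    show "(\<integral>\<^sup>+x. std_normal_density (x \<bullet> u) * f (x + s *\<^sub>R u) \<partial>lborel)
        = (\<integral>\<^sup>+x. std_normal_density (x \<bullet> u - s) * f x \<partial>lborel)"
      using nn_integral_lborel_shift[of "\<lambda>x. std_normal_density (x \<bullet> u - s) * f x" "s *\<^sub>R u"]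
      by (simp add: inner_add_left uu)
  qed
  also have "\<dots> = (\<integral>\<^sup>+x. (\<integral>\<^sup>+s. std_normal_density (x \<bullet> u - s) * f x \<partial>lborel) \<partial>lborel)"
    by (rule lborel_pair.Fubini') measurable
  also have "\<dots> = (\<integral>\<^sup>+x. f x \<partial>lborel)"
  proof (rule nn_integral_cong)
    fix x :: 'a
    have "(\<integral>\<^sup>+s. ennreal (std_normal_density (x \<bullet> u - s)) \<partial>lborel) = 1"
      using nn_integral_real_affine[of "\<lambda>s. ennreal (std_normal_density s)" "-1" "x \<bullet> u"]
      by (simp add: nn_integral_std_normal_density)
    then show "(\<integral>\<^sup>+s. std_normal_density (x \<bullet> u - s) * f x \<partial>lborel) = f x"
      by (simp add: nn_integral_multc)
  qed
  finally show ?thesis by simp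
qed

lemma nn_integral_lborel_mono_on_lines:
  fixes f g :: "'a::euclidean_space \<Rightarrow> ennreal" and u :: 'a
  assumes [measurable]: "f \<in> borel_measurable borel" "g \<in> borel_measurable borel"
    and u: "norm u = 1"
    and le: "\<And>y. y \<bullet> u = 0 \<Longrightarrow> (\<integral>\<^sup>+s. f (y + s *\<^sub>R u) \<partial>lborel) \<le> (\<integral>\<^sup>+s. g (y + s *\<^sub>R u) \<partial>lborel)"
  shows "(\<integral>\<^sup>+x. f x \<partial>lborel) \<le> (\<integral>\<^sup>+x. g x \<partial>lborel)"
proof -
  have base: "(\<integral>\<^sup>+s. h (x + s *\<^sub>R u) \<partial>lborel) = (\<integral>\<^sup>+s. h (x - (x \<bullet> u) *\<^sub>R u + s *\<^sub>R u) \<partial>lborel)"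
    if [measurable]: "h \<in> borel_measurable borel" for h :: "'a \<Rightarrow> ennreal" and x
    using nn_integral_lborel_shift[of "\<lambda>s. h (x - (x \<bullet> u) *\<^sub>R u + s *\<^sub>R u)" "x \<bullet> u"]
    by (simp add: algebra_simps)
  have "u \<bullet> u = 1" using u by (simp add: norm_eq_1)
  then have "(x - (x \<bullet> u) *\<^sub>R u) \<bullet> u = 0" for x by (simp add: inner_diff_left)
  then have line: "(\<integral>\<^sup>+s. f (x + s *\<^sub>R u) \<partial>lborel) \<le> (\<integral>\<^sup>+s. g (x + s *\<^sub>R u) \<partial>lborel)" for x
    using le[of "x - (x \<bullet> u) *\<^sub>R u"] base[of f x] base[of g x] by simp
  show ?thesis
    unfolding nn_integral_lborel_along_lines[OF assms(1) u] nn_integral_lborel_along_lines[OF assms(2) u]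
    by (intro nn_integral_mono mult_left_mono line) simp
qed

text \<open>
  Jensen's inequality for the convex function \<open>exp\<close>: the mean of \<open>|s|\<close> under the standard normal
  distribution is \<open>sqrt (2 / pi)\<close>.
\<close>

lemma std_normal_exp_abs_lower_bound:
  assumes "0 \<le> a"
  shows "ennreal (exp (- a * sqrt (2 / pi))) \<le> (\<integral>\<^sup>+s. std_normal_density s * exp (- a * \<bar>s\<bar>) \<partial>lborel)"
proof -
  define m where "m = sqrt (2 / pi)"
  \<comment> \<open>The tangent of \<open>exp (- a * \<bar>s\<bar>)\<close>, as a function of \<open>\<bar>s\<bar>\<close>, at the mean \<open>m\<close>.\<close>
  let ?l = "\<lambda>s. exp (- a * m) * ((1 + a * m) * std_normal_density s - a * (std_normal_density s * \<bar>s\<bar>))"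
  have abs1: "has_bochner_integral lborel (\<lambda>s. std_normal_density s * \<bar>s\<bar>) m"
    using std_normal_moment_abs_odd[of 0] by (simp add: m_def)
  have int1: "has_bochner_integral lborel std_normal_density 1"
    by (simp add: has_bochner_integral_iff integral_normal_density)
  have l: "has_bochner_integral lborel ?l (exp (- a * m) * ((1 + a * m) * 1 - a * m))"
    by (intro has_bochner_integral_mult_right has_bochner_integral_diff int1 abs1)
  have le: "?l s \<le> std_normal_density s * exp (- a * \<bar>s\<bar>)" for s
  proof -
    have "exp (- a * m) * (1 + (a * m - a * \<bar>s\<bar>)) \<le> exp (- a * m) * exp (a * m - a * \<bar>s\<bar>)"
      by (intro mult_left_mono exp_ge_add_one_self) simp
    also have "\<dots> = exp (- a * \<bar>s\<bar>)" by (simp add: exp_add[symmetric])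
    finally have "std_normal_density s * (exp (- a * m) * (1 + (a * m - a * \<bar>s\<bar>)))
        \<le> std_normal_density s * exp (- a * \<bar>s\<bar>)" by (intro mult_left_mono) auto
    then show ?thesis by (simp add: algebra_simps)
  qed
  have int: "integrable lborel (\<lambda>s. std_normal_density s * exp (- a * \<bar>s\<bar>))"
  proof (rule Bochner_Integration.integrable_bound)
    show "integrable lborel std_normal_density" by simp
    show "AE s in lborel. norm (std_normal_density s * exp (- a * \<bar>s\<bar>)) \<le> norm (std_normal_density s)"
      using assms by (intro AE_I2) (simp add: abs_mult mult_left_le)
  qed simp
  have "exp (- a * m) = integral\<^sup>L lborel ?l"
    using has_bochner_integral_integral_eq[OF l] by simp
  also have "\<dots> \<le> integral\<^sup>L lborel (\<lambda>s. std_normal_density s * exp (- a * \<bar>s\<bar>))"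
    using l int le by (intro integral_mono) (auto simp: has_bochner_integral_iff)
  finally show ?thesis
    using int by (subst nn_integral_eq_integral) (auto simp: m_def intro!: ennreal_leI)
qed

text \<open>
  Moving the two open half-lines outwards by \<open>a\<close> turns the left side into the mass of two open tails.
  The closed tails on the right contain, beyond that, only their boundary points.
\<close>

lemma std_normal_two_sided_tail_shift:
  assumes a: "0 \<le> a"
  shows "(\<integral>\<^sup>+s. std_normal_density (\<bar>s\<bar> + a) \<partial>lborel)
       \<le> (\<integral>\<^sup>+s. ennreal (std_normal_density s) * indicator {s. a \<le> \<bar>s\<bar>} s \<partial>lborel)"
proof -
  let ?\<phi> = std_normal_density
  have even: "?\<phi> (- s) = ?\<phi> s" for s by (simp add: normal_density_def)
  have [measurable]: "{s::real. a \<le> \<bar>s\<bar>} \<in> sets borel" by measurable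
  have "(\<integral>\<^sup>+s. ?\<phi> (\<bar>s\<bar> + a) \<partial>lborel)
      = (\<integral>\<^sup>+s. ennreal (?\<phi> (s + a)) * indicator {0<..} s + ennreal (?\<phi> (s + - a)) * indicator {..<0} s \<partial>lborel)"
  proof (rule nn_integral_cong_AE)
    have "ennreal (?\<phi> (\<bar>s\<bar> + a)) = ennreal (?\<phi> (s + a)) * indicator {0<..} s + ennreal (?\<phi> (s + - a)) * indicator {..<0} s"
      if "s \<noteq> 0" for s
      using that even[of "s - a"] by (auto simp: indicator_def abs_if)
    then show "AE s in lborel. ennreal (?\<phi> (\<bar>s\<bar> + a))
        = ennreal (?\<phi> (s + a)) * indicator {0<..} s + ennreal (?\<phi> (s + - a)) * indicator {..<0} s"
      using AE_lborel_singleton[of "0::real"] by auto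
  qed
  also have "\<dots> = (\<integral>\<^sup>+s. ennreal (?\<phi> (s + a)) * indicator {a<..} (s + a) \<partial>lborel)
      + (\<integral>\<^sup>+s. ennreal (?\<phi> (s + - a)) * indicator {..<-a} (s + - a) \<partial>lborel)"
    by (subst nn_integral_add) (auto simp: indicator_def intro!: arg_cong2[where f="(+)"] nn_integral_cong)
  also have "\<dots> = (\<integral>\<^sup>+s. ennreal (?\<phi> s) * indicator {a<..} s \<partial>lborel)
      + (\<integral>\<^sup>+s. ennreal (?\<phi> s) * indicator {..<-a} s \<partial>lborel)"
    using nn_integral_lborel_shift[of "\<lambda>s. ennreal (?\<phi> s) * indicator {a<..} s" a]
      nn_integral_lborel_shift[of "\<lambda>s. ennreal (?\<phi> s) * indicator {..<-a} s" "- a"] by simp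
  also have "\<dots> = (\<integral>\<^sup>+s. ennreal (?\<phi> s) * indicator {a<..} s + ennreal (?\<phi> s) * indicator {..<-a} s \<partial>lborel)"
    by (subst nn_integral_add) auto
  also have "\<dots> \<le> (\<integral>\<^sup>+s. ennreal (?\<phi> s) * indicator {s. a \<le> \<bar>s\<bar>} s \<partial>lborel)"
    using a by (intro nn_integral_mono) (auto simp: indicator_def)
  finally show ?thesis .
qed

lemma two_over_pi_le_ln_2: "2 / pi \<le> ln 2"
proof -
  have "2 / pi \<le> 2 / 3" using pi_gt3 by (intro divide_left_mono) auto
  also have "\<dots> \<le> ln 2" using ln2_ge_two_thirds by simp
  finally show ?thesis .
qed

text \<open>
  After the shift by \<open>a\<close> the density splits off the factor \<open>exp (- a\<^sup>2 / 2)\<close>, and Jensen's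
  inequality leaves \<open>exp (- a\<^sup>2 / 2 - a m)\<close> with \<open>m = sqrt (2 / pi)\<close>. Replacing the linear term
  by a quadratic one costs a constant factor: \<open>a m \<le> (a\<^sup>2 + m\<^sup>2) / 2\<close>, and
  \<open>m\<^sup>2 = 2 / pi \<le> ln 2\<close>. The purely quadratic exponent is what makes the bound integrable in
  closed form over the orthogonal directions, and the constant \<open>1 / sqrt 2\<close> is just large enough
  for dimension two.
\<close>

lemma std_normal_two_sided_tail_lower_bound:
  assumes a: "0 \<le> a"
  shows "ennreal (exp (- a\<^sup>2) / sqrt 2)
       \<le> (\<integral>\<^sup>+s. ennreal (std_normal_density s) * indicator {s. a \<le> \<bar>s\<bar>} s \<partial>lborel)"
proof -
  define m where "m = sqrt (2 / pi)"
  have "m\<^sup>2 \<le> ln 2" using two_over_pi_le_ln_2 by (simp add: m_def)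
  moreover have "0 \<le> (a - m)\<^sup>2" by simp
  ultimately have "- a\<^sup>2 - ln 2 / 2 \<le> - (a\<^sup>2 / 2) + - a * m"
    by (simp add: power2_diff)
  then have "exp (- a\<^sup>2 - ln 2 / 2) \<le> exp (- (a\<^sup>2 / 2)) * exp (- a * m)"
    by (simp add: exp_add[symmetric])
  moreover have "exp (ln 2 / 2) = sqrt (2::real)"
    by (metis exp_ln powr_half_sqrt powr_def mult.commute times_divide_eq_left mult_1 zero_less_numeral zero_le_numeral zero_neq_numeral)
  ultimately have "exp (- a\<^sup>2) / sqrt 2 \<le> exp (- (a\<^sup>2 / 2)) * exp (- a * m)"
    by (simp add: exp_diff)
  then have "ennreal (exp (- a\<^sup>2) / sqrt 2) \<le> ennreal (exp (- (a\<^sup>2 / 2))) * ennreal (exp (- a * m))"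
    by (simp add: ennreal_mult[symmetric] ennreal_leI)
  also have "\<dots> \<le> ennreal (exp (- (a\<^sup>2 / 2))) * (\<integral>\<^sup>+s. std_normal_density s * exp (- a * \<bar>s\<bar>) \<partial>lborel)"
    unfolding m_def by (intro mult_left_mono std_normal_exp_abs_lower_bound a) simp
  also have "\<dots> = (\<integral>\<^sup>+s. ennreal (exp (- (a\<^sup>2 / 2))) * ennreal (std_normal_density s * exp (- a * \<bar>s\<bar>)) \<partial>lborel)"
    by (subst nn_integral_cmult) auto
  also have "\<dots> = (\<integral>\<^sup>+s. std_normal_density (\<bar>s\<bar> + a) \<partial>lborel)"
  proof (intro nn_integral_cong)
    fix s :: real
    have "exp (- (a\<^sup>2 / 2)) * (std_normal_density s * exp (- a * \<bar>s\<bar>)) = std_normal_density (\<bar>s\<bar> + a)"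
      by (simp add: std_normal_density_def exp_add[symmetric] power2_sum field_simps)
    then show "ennreal (exp (- (a\<^sup>2 / 2))) * ennreal (std_normal_density s * exp (- a * \<bar>s\<bar>))
        = ennreal (std_normal_density (\<bar>s\<bar> + a))"
      by (simp add: ennreal_mult[symmetric])
  qed
  also note std_normal_two_sided_tail_shift[OF a]
  finally show ?thesis .
qed

lemma std_gaussian_density_eq:
  fixes x :: "real ^ 'n"
  shows "std_gaussian_density x = (1 / sqrt (2 * pi)) ^ CARD('n) * exp (- (norm x)\<^sup>2 / 2)"
proof -
  have "- (norm x)\<^sup>2 / 2 = (\<Sum>i\<in>UNIV. - (x $ i)\<^sup>2 / 2)"
    by (simp add: norm_vec_def L2_set_def sum_nonneg sum_divide_distrib sum_negf)
  then have "exp (- (norm x)\<^sup>2 / 2) = (\<Prod>i\<in>UNIV. exp (- (x $ i)\<^sup>2 / 2))"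
    by (simp only: exp_sum finite_UNIV finite)
  then show ?thesis
    by (simp add: std_gaussian_density_def std_normal_density_def prod_dividef power_divide)
qed

lemma std_gaussian_density_measurable [measurable]:
  "std_gaussian_density \<in> borel_measurable (borel :: (real ^ 'n) measure)"
  unfolding std_gaussian_density_eq[abs_def] by measurable

lemma std_gaussian_density_nonneg [simp]: "0 \<le> std_gaussian_density x"
  by (simp add: std_gaussian_density_eq)

lemma nn_integral_std_gaussian_density:
  "(\<integral>\<^sup>+x. ennreal (std_gaussian_density (x :: real ^ 'n)) \<partial>lborel) = 1"
proof -
  have "ennreal (std_gaussian_density x) = (\<Prod>b\<in>Basis. ennreal (std_normal_density (x \<bullet> b)))"
    for x :: "real ^ 'n"
  proof -
    have "(\<Prod>b\<in>Basis. std_normal_density (x \<bullet> b)) = (\<Prod>i\<in>UNIV. std_normal_density (x $ i))"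
    proof -
      have "inj (\<lambda>i :: 'n. axis i (1::real))" by (auto intro!: inj_onI simp: axis_eq_axis)
      then show ?thesis
        unfolding Basis_vec_def by (simp add: UNION_singleton_eq_range prod.reindex inner_axis)
    qed
    then show ?thesis by (simp add: std_gaussian_density_def prod_ennreal)
  qed
  then show ?thesis
    using nn_integral_lborel_prod[of "\<lambda>_ :: real ^ 'n. \<lambda>s. ennreal (std_normal_density s)"]
    by (simp add: nn_integral_std_normal_density)
qed

lemma std_gaussian_density_line:
  fixes y u :: "real ^ 'n"
  assumes "norm u = 1" "y \<bullet> u = 0"
  shows "std_gaussian_density (y + s *\<^sub>R u)
       = std_gaussian_density y * sqrt (2 * pi) * std_normal_density s"
proof -
  have "(norm (y + s *\<^sub>R u))\<^sup>2 = (norm y)\<^sup>2 + s\<^sup>2"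
    using assms norm_add_Pythagorean[of y "s *\<^sub>R u"] by (simp add: orthogonal_def)
  then show ?thesis
    by (simp add: std_gaussian_density_eq std_normal_density_def exp_add[symmetric] field_simps)
qed

lemma double_cone_borel [measurable]: "double_cone u \<tau> \<in> sets borel"
  unfolding double_cone_def by measurable

text \<open>
  The function \<open>r / sqrt 2 * std_gaussian_density (r x)\<close> with \<open>r\<^sup>2 = 1 + 2 \<tau>\<^sup>2\<close> is chosen such
  that its integral over the line through \<open>y \<bottom> u\<close> is the density at \<open>y\<close> times the lower bound
  for the tail beyond \<open>\<tau> |y|\<close>, up to the common factor \<open>sqrt (2 pi)\<close>. Its integral over the
  whole space follows by scaling.
\<close>

lemma std_gaussian_double_cone_lower_bound:
  fixes u :: "real ^ 'n"
  assumes u: "norm u = 1" and \<tau>: "0 \<le> \<tau>"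
  shows "ennreal (1 / sqrt 2 * (1 / sqrt (1 + 2 * \<tau>\<^sup>2)) ^ (CARD('n) - 1))
       \<le> (\<integral>\<^sup>+x. ennreal (std_gaussian_density x) * indicator (double_cone u \<tau>) x \<partial>lborel)"
proof -
  define r where "r = sqrt (1 + 2 * \<tau>\<^sup>2)"
  have r2: "r\<^sup>2 = 1 + 2 * \<tau>\<^sup>2" unfolding r_def by (simp add: add_nonneg_nonneg)
  have r: "0 < r" unfolding r_def by (simp add: add_pos_nonneg)
  have "(\<integral>\<^sup>+x. ennreal (r / sqrt 2) * ennreal (std_gaussian_density (r *\<^sub>R x)) \<partial>(lborel :: (real ^ 'n) measure))
      \<le> (\<integral>\<^sup>+x. ennreal (std_gaussian_density x) * indicator (double_cone u \<tau>) x \<partial>lborel)"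
  proof (rule nn_integral_lborel_mono_on_lines[OF _ _ u])
    fix y :: "real ^ 'n"
    assume y: "y \<bullet> u = 0"
    \<comment> \<open>\<open>G\<close> is the factor by which the density on the line differs from the standard
    normal density, and \<open>a\<close> is the distance at which the line enters the double cone.\<close>
    define G where "G = std_gaussian_density y * sqrt (2 * pi)"
    define a where "a = \<tau> * norm y"
    have a: "0 \<le> a" using \<tau> by (simp add: a_def)
    have G0: "0 \<le> G" by (simp add: G_def)
    have R: "std_gaussian_density (r *\<^sub>R y) * sqrt (2 * pi) = G * exp (- a\<^sup>2)"
      unfolding G_def a_def std_gaussian_density_eq
      by (simp add: power_mult_distrib r2 exp_add[symmetric] field_simps)
    have "(\<integral>\<^sup>+s. ennreal (r / sqrt 2) * ennreal (std_gaussian_density (r *\<^sub>R (y + s *\<^sub>R u))) \<partial>lborel)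
        = (\<integral>\<^sup>+s. ennreal (G * exp (- a\<^sup>2) * (r / sqrt 2)) * ennreal (std_normal_density (r *\<^sub>R s)) \<partial>lborel)"
    proof (rule nn_integral_cong)
      fix s :: real
      have "std_gaussian_density (r *\<^sub>R (y + s *\<^sub>R u)) = G * exp (- a\<^sup>2) * std_normal_density (r *\<^sub>R s)"
        using std_gaussian_density_line[OF u, of "r *\<^sub>R y" "r * s"] y
        by (simp add: scaleR_add_right R)
      then show "ennreal (r / sqrt 2) * ennreal (std_gaussian_density (r *\<^sub>R (y + s *\<^sub>R u)))
          = ennreal (G * exp (- a\<^sup>2) * (r / sqrt 2)) * ennreal (std_normal_density (r *\<^sub>R s))"
        using r G0 by (simp add: ennreal_mult[symmetric] mult_ac)
    qed
    also have "\<dots> = ennreal (G * exp (- a\<^sup>2) * (r / sqrt 2)) * ennreal (1 / r)"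
      using nn_integral_lborel_scaleR[of "\<lambda>s::real. ennreal (std_normal_density s)" r] r
      by (simp add: nn_integral_cmult nn_integral_std_normal_density)
    also have "\<dots> = ennreal G * ennreal (exp (- a\<^sup>2) / sqrt 2)"
      using r G0 by (simp add: ennreal_mult[symmetric])
    also have "\<dots> \<le> ennreal G * (\<integral>\<^sup>+s. ennreal (std_normal_density s) * indicator {s. a \<le> \<bar>s\<bar>} s \<partial>lborel)"
      by (intro mult_left_mono std_normal_two_sided_tail_lower_bound a) simp
    also have "\<dots> = (\<integral>\<^sup>+s. ennreal G * (ennreal (std_normal_density s) * indicator {s. a \<le> \<bar>s\<bar>} s) \<partial>lborel)"
      by (subst nn_integral_cmult) (auto, measurable)
    also have "\<dots> = (\<integral>\<^sup>+s. ennreal (std_gaussian_density (y + s *\<^sub>R u))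
        * indicator (double_cone u \<tau>) (y + s *\<^sub>R u) \<partial>lborel)"
    proof (rule nn_integral_cong)
      fix s :: real
      have "(y + s *\<^sub>R u) \<bullet> u = s" using u y by (simp add: inner_add_left norm_eq_1)
      then have "y + s *\<^sub>R u \<in> double_cone u \<tau> \<longleftrightarrow> a \<le> \<bar>s\<bar>"
        by (simp add: double_cone_def a_def)
      then show "ennreal G * (ennreal (std_normal_density s) * indicator {s. a \<le> \<bar>s\<bar>} s)
          = ennreal (std_gaussian_density (y + s *\<^sub>R u)) * indicator (double_cone u \<tau>) (y + s *\<^sub>R u)"
        using std_gaussian_density_line[OF u y, of s] G0
        by (auto simp: indicator_def G_def ennreal_mult[symmetric])
    qed
    finally show "(\<integral>\<^sup>+s. ennreal (r / sqrt 2) * ennreal (std_gaussian_density (r *\<^sub>R (y + s *\<^sub>R u))) \<partial>lborel)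
        \<le> (\<integral>\<^sup>+s. ennreal (std_gaussian_density (y + s *\<^sub>R u)) * indicator (double_cone u \<tau>) (y + s *\<^sub>R u) \<partial>lborel)" .
  qed measurable
  moreover have "(\<integral>\<^sup>+x. ennreal (r / sqrt 2) * ennreal (std_gaussian_density (r *\<^sub>R x)) \<partial>(lborel :: (real ^ 'n) measure))
      = ennreal (r / sqrt 2) * ennreal (1 / r ^ CARD('n))"
    using nn_integral_lborel_scaleR[of "\<lambda>x :: real ^ 'n. ennreal (std_gaussian_density x)" r] r
    by (simp add: nn_integral_cmult nn_integral_std_gaussian_density)
  moreover have "r / sqrt 2 * (1 / r ^ CARD('n)) = 1 / sqrt 2 * (1 / r) ^ (CARD('n) - 1)"
  proof -
    obtain m where "CARD('n) = Suc m" by (metis zero_less_card_finite gr0_implies_Suc)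
    then show ?thesis using r by (simp add: power_divide)
  qed
  ultimately show ?thesis
    using r by (simp add: ennreal_mult[symmetric] r_def)
qed

text \<open>In dimension one, the component orthogonal to a unit vector vanishes.\<close>

lemma double_cone_one_dimensional:
  fixes u :: "real ^ 'n"
  assumes u: "norm u = 1" and "CARD('n) = 1"
  shows "double_cone u \<tau> = UNIV"
proof -
  have "x = (x \<bullet> u) *\<^sub>R u" for x
  proof (rule ccontr)
    assume ne: "x \<noteq> (x \<bullet> u) *\<^sub>R u"
    define y where "y = x - (x \<bullet> u) *\<^sub>R u"
    have uu: "u \<bullet> u = 1" using u by (simp add: norm_eq_1)
    have y: "y \<noteq> 0" "y \<bullet> u = 0" using ne by (auto simp: y_def inner_diff_left uu)
    have "u \<noteq> 0" "y \<noteq> u" using uu y by auto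
    then have "independent {y, u}"
      using y by (intro pairwise_orthogonal_independent) (auto simp: pairwise_def orthogonal_def inner_commute)
    then have "card {y, u} \<le> 1" using independent_bound[of "{y, u}"] assms(2) by simp
    then show False using \<open>y \<noteq> u\<close> by simp
  qed
  then show ?thesis by (auto simp: double_cone_def)
qed

text \<open>
  With \<open>q = sqrt (1 + \<tau>\<^sup>2)\<close> the sine equals \<open>\<tau> / q\<close>. After multiplication by \<open>q (q + \<tau>)\<close> the
  claim becomes \<open>1 + 2 \<tau>\<^sup>2 \<le> q (q + \<tau>)\<close>, that is, \<open>\<tau>\<^sup>2 \<le> q \<tau>\<close>.
\<close>

lemma one_minus_sin_arctan_bound:
  assumes "0 \<le> \<tau>"
  shows "(1 - sin (arctan \<tau>)) * (1 + 2 * \<tau>\<^sup>2) \<le> 1"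
proof -
  define q where "q = sqrt (1 + \<tau>\<^sup>2)"
  have q2: "q\<^sup>2 = 1 + \<tau>\<^sup>2" by (simp add: q_def add_nonneg_nonneg)
  have q: "\<tau> < q" "0 < q" using assms by (auto simp: q_def real_less_rsqrt add_pos_nonneg)
  have "(q - \<tau>) * (1 + 2 * \<tau>\<^sup>2) * (q + \<tau>) = (q\<^sup>2 - \<tau>\<^sup>2) * (1 + 2 * \<tau>\<^sup>2)"
    by (simp add: algebra_simps power2_eq_square)
  also have "\<dots> = q\<^sup>2 + \<tau> * \<tau>" unfolding q2 by (simp add: power2_eq_square)
  also have "\<dots> \<le> q\<^sup>2 + q * \<tau>" using q assms by (simp add: mult_right_mono)
  also have "\<dots> = q * (q + \<tau>)" by (simp add: power2_eq_square distrib_left)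
  finally have "(q - \<tau>) * (1 + 2 * \<tau>\<^sup>2) \<le> q" using q assms by (simp add: mult_le_cancel_right)
  moreover have "sin (arctan \<tau>) = \<tau> / q" by (simp add: sin_arctan q_def)
  moreover have "1 - \<tau> / q = (q - \<tau>) / q" using q by (simp add: field_simps)
  ultimately show ?thesis using q by simp
qed

lemma sin_arctan_less_1: "sin (arctan \<tau>) < 1"
proof -
  have "\<tau> \<le> sqrt (\<tau>\<^sup>2)" by simp
  also have "\<dots> < sqrt (1 + \<tau>\<^sup>2)" by (rule real_sqrt_less_mono) simp
  finally show ?thesis by (simp add: sin_arctan divide_less_eq add_pos_nonneg)
qed

text \<open>
  By the preceding estimate the base of the power is at most \<open>1 / (2 (1 + 2 \<tau>\<^sup>2))\<close>. For \<open>n \<ge> 2\<close>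
  the factor \<open>(1 / sqrt 2)^(n - 1)\<close> obtained in this way pays for the constant \<open>1 / sqrt 2\<close> lost
  in the tail bound; for \<open>n = 1\<close> it does not, but there the double cone has full measure.
\<close>

lemma std_gaussian_double_cone_ge:
  fixes u :: "real ^ 'n"
  assumes u: "norm u = 1" and \<tau>: "0 \<le> \<tau>"
  shows "ennreal ((1 / 2 * (1 - sin (arctan \<tau>))) powr ((real CARD('n) - 1) / 2))
       \<le> (\<integral>\<^sup>+x. ennreal (std_gaussian_density x) * indicator (double_cone u \<tau>) x \<partial>lborel)"
proof (cases "CARD('n) = 1")
  case True
  then show ?thesis
    using sin_arctan_less_1[of \<tau>] double_cone_one_dimensional[OF u True]
    by (simp add: nn_integral_std_gaussian_density)
next
  case False
  define N where "N = CARD('n) - 1"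
  have "0 < CARD('n)" by simp
  then have N: "real CARD('n) - 1 = real N" "1 \<le> N" using False unfolding N_def by linarith+
  define B where "B = 1 / 2 * (1 - sin (arctan \<tau>))"
  define A where "A = 1 + 2 * \<tau>\<^sup>2"
  have B: "0 < B" using sin_arctan_less_1[of \<tau>] by (simp add: B_def)
  have A: "0 < A" by (simp add: A_def add_pos_nonneg)
  have "B * A \<le> 1 / 2" using one_minus_sin_arctan_bound[OF \<tau>] by (simp add: A_def B_def)
  then have "B \<le> 1 / 2 * (1 / A)" using A by (simp add: field_simps)
  then have "sqrt B \<le> sqrt (1 / 2 * (1 / A))" by simp
  then have sB: "sqrt B \<le> 1 / sqrt 2 * (1 / sqrt A)" by (simp add: real_sqrt_mult real_sqrt_divide)
  have "B powr (real N / 2) = (B powr (1 / 2)) powr real N" by (simp add: powr_powr)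
  also have "\<dots> = (sqrt B) ^ N" using B by (simp add: powr_half_sqrt powr_realpow)
  also have "\<dots> \<le> (1 / sqrt 2 * (1 / sqrt A)) ^ N" using sB B by (intro power_mono) auto
  also have "\<dots> = (1 / sqrt 2) ^ N * (1 / sqrt A) ^ N" by (rule power_mult_distrib)
  also have "\<dots> \<le> 1 / sqrt 2 * (1 / sqrt A) ^ N"
    using N(2) A power_decreasing[of 1 N "1 / sqrt 2 :: real"] by (intro mult_right_mono) auto
  finally show ?thesis
    using std_gaussian_double_cone_lower_bound[OF u \<tau>]
    unfolding N(1) B_def[symmetric] A_def[symmetric] N_def[symmetric]
    by (meson ennreal_leI order_trans)
qed

section \<open>Hitting all normal cones with independent Gaussian vectors\<close>

lemma normal_cone_borel [measurable]: "normal_cone K v \<in> sets borel"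
proof -
  have "normal_cone K v = (\<Inter>z\<in>K. {x. (z - v) \<bullet> x \<le> 0})"
    by (auto simp: normal_cone_def inner_commute)
  moreover have "closed \<dots>" by (intro closed_INT ballI closed_halfspace_le)
  ultimately show ?thesis by simp
qed

lemma (in prob_space) prob_normal_cones_ge:
  fixes K :: "(real ^ 'n) set" and Y :: "'a \<Rightarrow> real ^ 'n"
  assumes K: "polytope K" "centrally_symmetric K" and v: "v \<in> vert K"
    and \<delta>: "0 < \<delta>" "ereal \<delta> \<le> simplicial_constant K v"
    and b: "diameter (vertex_base K v) \<le> b"
    and Y: "std_gaussian_vector M Y"
  shows "(1 / 2 * (1 - sin (arctan (b / \<delta>)))) powr ((real CARD('n) - 1) / 2)
       \<le> prob (Y -` (normal_cone K v \<union> normal_cone K (- v)) \<inter> space M)"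
proof -
  let ?N = "normal_cone K v \<union> normal_cone K (- v)"
  have "bounded (vertex_base K v)"
    unfolding vertex_base_def
    using polytope_eq_convex_hull_vert(1)[OF K(1)] by (simp add: finite_imp_bounded_convex_hull)
  then have "0 \<le> b" using b diameter_ge_0 by (meson order_trans)
  then have \<tau>: "0 \<le> b / \<delta>" using \<delta> by simp
  obtain u where u: "norm u = 1" "double_cone u (b / \<delta>) \<subseteq> ?N"
    using double_cone_subset_normal_cones[OF K v \<delta> b] by blast
  have D: "distributed M lborel Y (\<lambda>x. ennreal (std_gaussian_density x))"
    using Y by (simp add: std_gaussian_vector_def)
  have "ennreal ((1 / 2 * (1 - sin (arctan (b / \<delta>)))) powr ((real CARD('n) - 1) / 2))
      \<le> (\<integral>\<^sup>+x. ennreal (std_gaussian_density x) * indicator (double_cone u (b / \<delta>)) x \<partial>lborel)"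
    by (rule std_gaussian_double_cone_ge[OF u(1) \<tau>])
  also have "\<dots> = emeasure M (Y -` double_cone u (b / \<delta>) \<inter> space M)"
    using distributed_emeasure[OF D, of "double_cone u (b / \<delta>)"] by simp
  also have "\<dots> = ennreal (prob (Y -` double_cone u (b / \<delta>) \<inter> space M))"
    by (rule emeasure_eq_measure)
  finally have "(1 / 2 * (1 - sin (arctan (b / \<delta>)))) powr ((real CARD('n) - 1) / 2)
      \<le> prob (Y -` double_cone u (b / \<delta>) \<inter> space M)" by simp
  also have "\<dots> \<le> prob (Y -` ?N \<inter> space M)"
  proof (rule finite_measure_mono)
    have "Y \<in> measurable M borel" using distributed_measurable[OF D] by simp
    then show "Y -` ?N \<inter> space M \<in> events" by measurable
  qed (use u in blast)
  finally show ?thesis .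
qed

text \<open>
  By independence, all \<open>p\<close> variables miss a fixed \<open>N v\<close> with probability at most \<open>(1 - k)^p\<close>;
  the union bound over \<open>V\<close> gives the rest.
\<close>

lemma (in prob_space) prob_hits_all_ge:
  fixes N :: "'v \<Rightarrow> 'b::topological_space set" and X :: "nat \<Rightarrow> 'a \<Rightarrow> 'b"
  assumes V: "finite V" and N: "\<And>v. v \<in> V \<Longrightarrow> N v \<in> sets borel"
    and X: "indep_vars (\<lambda>_. borel) X {1..p}"
    and hit: "\<And>v i. v \<in> V \<Longrightarrow> i \<in> {1..p} \<Longrightarrow> k \<le> prob (X i -` N v \<inter> space M)"
  shows "1 - real (card V) * (1 - k) ^ p
       \<le> prob {\<omega> \<in> space M. \<forall>v\<in>V. {X i \<omega> | i. i \<in> {1..p}} \<inter> N v \<noteq> {}}"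
proof -
  define Miss where "Miss v = {\<omega> \<in> space M. \<forall>i\<in>{1..p}. X i \<omega> \<in> - N v}" for v
  have rv: "X i \<in> measurable M borel" if "i \<in> {1..p}" for i
    using X that unfolding indep_vars_def by auto
  have ev: "X i -` N v \<inter> space M \<in> events" if "v \<in> V" "i \<in> {1..p}" for v i
    using rv[OF that(2)] N[OF that(1)] by (rule measurable_sets)
  have Miss_ev: "Miss v \<in> events" if "v \<in> V" for v
  proof -
    have "Miss v = space M - (\<Union>i\<in>{1..p}. X i -` N v \<inter> space M)" by (auto simp: Miss_def)
    moreover have "(\<Union>i\<in>{1..p}. X i -` N v \<inter> space M) \<in> events"
      using ev[OF that] by (intro sets.finite_UN) auto
    ultimately show ?thesis by auto
  qed
  have Miss_prob: "prob (Miss v) \<le> (1 - k) ^ p" if v: "v \<in> V" for v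
  proof (cases "p = 0")
    case True then show ?thesis by simp
  next
    case False
    have "Miss v = (\<Inter>i\<in>{1..p}. X i -` (- N v) \<inter> space M)" using False by (auto simp: Miss_def)
    then have "prob (Miss v) = (\<Prod>i\<in>{1..p}. prob (X i -` (- N v) \<inter> space M))"
      using indep_varsD_finite[OF X, of "\<lambda>_. - N v"] False N[OF v]
      by simp
    also have "\<dots> \<le> (\<Prod>i\<in>{1..p}. 1 - k)"
    proof (intro prod_mono conjI)
      fix i assume i: "i \<in> {1..p}"
      have "X i -` (- N v) \<inter> space M = space M - (X i -` N v \<inter> space M)" by auto
      then show "prob (X i -` (- N v) \<inter> space M) \<le> 1 - k"
        using hit[OF v i] prob_compl[OF ev[OF v i]] by simp
    qed simp
    finally show ?thesis by simp
  qed
  have "{X i \<omega> | i. i \<in> {1..p}} \<inter> N v \<noteq> {} \<longleftrightarrow> (\<exists>i\<in>{1..p}. X i \<omega> \<in> N v)" for v \<omega>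
    by blast
  then have "{\<omega> \<in> space M. \<forall>v\<in>V. {X i \<omega> | i. i \<in> {1..p}} \<inter> N v \<noteq> {}} = space M - (\<Union>v\<in>V. Miss v)"
    unfolding Miss_def by auto
  moreover have "(\<Union>v\<in>V. Miss v) \<in> events" using V Miss_ev by auto
  moreover have "prob (\<Union>v\<in>V. Miss v) \<le> (\<Sum>v\<in>V. prob (Miss v))"
    using V Miss_ev by (intro finite_measure_subadditive_finite) auto
  moreover have "\<dots> \<le> real (card V) * (1 - k) ^ p"
    using Miss_prob sum_bounded_above[of V "\<lambda>v. prob (Miss v)" "(1 - k) ^ p"] by auto
  ultimately show ?thesis by (simp add: prob_compl)
qed

text \<open>
  Exponentiate the hypothesis. For \<open>k = 1\<close> the conventions \<open>1 / 0 = 0\<close> and \<open>ln 0 = 0\<close>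
  turn it into \<open>0 < p\<close>, which suffices because then \<open>(1 - k)^p = 0\<close>; this case arises in dimension one.
\<close>

lemma union_bound_sample_size:
  fixes \<epsilon> k m :: real
  assumes "0 < \<epsilon>" "0 < k" "k \<le> 1" "0 < m" and p: "ln (m / \<epsilon>) / ln (1 / (1 - k)) < real p"
  shows "m * (1 - k) ^ p \<le> \<epsilon>"
proof (cases "k = 1")
  case True
  then have "0 < p" using p by simp
  then show ?thesis using True assms(1) by (simp add: power_0_left)
next
  case False
  then have k: "0 < 1 - k" "1 - k < 1" using assms by auto
  then have pos: "0 < ln (1 / (1 - k))" by simp
  have "ln (m / \<epsilon>) < real p * ln (1 / (1 - k))" using p pos by (simp add: divide_less_eq)
  also have "\<dots> = ln ((1 / (1 - k)) ^ p)" using k by (simp add: ln_realpow)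
  finally have "m / \<epsilon> < (1 / (1 - k)) ^ p" using assms k by simp
  then show ?thesis using assms k by (simp add: power_divide field_simps)
qed

theorem theorem4:
  fixes \<epsilon> \<delta> b k :: real
    and S K U :: "(real ^ 'n) set"
    and M :: "'w measure"
    and X :: "nat \<Rightarrow> 'w \<Rightarrow> real ^ 'n"
    and p :: nat
  assumes "\<epsilon> > 0" and "\<delta> > 0"
    and "finite S" and "centrally_symmetric S" and "K = convex hull S"
    and "prob_space M"
    and "prob_space.indep_vars M (\<lambda>_. borel) X {1..p}"
    and "\<And>i. i \<in> {1..p} \<Longrightarrow> std_gaussian_vector M (X i)"
    and "U = {v \<in> vert K. simplicial_constant K v \<ge> ereal \<delta>}"
    and "b \<ge> Max ((\<lambda>v. diameter (vertex_base K v)) ` vert K)"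
    and "k = (1 / 2 * (1 - sin (arctan (b / \<delta>)))) powr ((real CARD('n) - 1) / 2)"
    and "real p > ln (real (card (vert K)) / \<epsilon>) / ln (1 / (1 - k))"
  shows "measure M {\<omega> \<in> space M. \<forall>v\<in>U.
           {X i \<omega> | i. i \<in> {1..p}} \<inter> (normal_cone K v \<union> normal_cone K (- v)) \<noteq> {}} \<ge> 1 - \<epsilon>"
proof -
  interpret prob_space M by fact
  have K: "polytope K" "centrally_symmetric K"
    using assms(3-5) by (auto simp: polytope_convex_hull centrally_symmetric_convex_hull)
  have fin: "finite (vert K)" by (rule polytope_eq_convex_hull_vert(1)[OF K(1)])
  have UV: "U \<subseteq> vert K" using assms(9) by blast
  have k0: "0 < k"
    using sin_arctan_less_1[of "b / \<delta>"] assms(11) by simp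
  have k1: "k \<le> 1"
  proof -
    have "-1 \<le> sin (arctan (b / \<delta>))" by simp
    then have "1 / 2 * (1 - sin (arctan (b / \<delta>))) \<le> 1" by simp
    moreover have "0 \<le> (real CARD('n) - 1) / 2" by (simp add: Suc_le_eq)
    ultimately show ?thesis
      using sin_arctan_less_1[of "b / \<delta>"] unfolding assms(11) by (intro powr_le1) auto
  qed
  have "1 - real (card U) * (1 - k) ^ p
      \<le> prob {\<omega> \<in> space M. \<forall>v\<in>U. {X i \<omega> | i. i \<in> {1..p}} \<inter> (normal_cone K v \<union> normal_cone K (- v)) \<noteq> {}}"
  proof (rule prob_hits_all_ge)
    show "finite U" using fin UV finite_subset by blast
    fix v i assume v: "v \<in> U" and i: "i \<in> {1..p}"
    have "diameter (vertex_base K v) \<le> Max ((\<lambda>v. diameter (vertex_base K v)) ` vert K)"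
      using fin v UV by (intro Max_ge) auto
    then have "diameter (vertex_base K v) \<le> b" using assms(10) by linarith
    then show "k \<le> prob (X i -` (normal_cone K v \<union> normal_cone K (- v)) \<inter> space M)"
      using prob_normal_cones_ge[OF K, of v \<delta> b "X i"] assms(2,8,9,11) v i by auto
  qed (use assms(7) in auto)
  moreover have "real (card U) * (1 - k) ^ p \<le> \<epsilon>"
  proof (cases "U = {}")
    case True then show ?thesis using assms(1) by simp
  next
    case False
    then have "0 < real (card (vert K))" using fin UV by (auto simp: card_gt_0_iff)
    then have "real (card (vert K)) * (1 - k) ^ p \<le> \<epsilon>"
      using union_bound_sample_size assms(1,12) k0 k1 by blast
    moreover have "real (card U) * (1 - k) ^ p \<le> real (card (vert K)) * (1 - k) ^ p"
      using k1 fin UV by (intro mult_right_mono) (auto simp: card_mono)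
    ultimately show ?thesis by linarith
  qed
  ultimately show ?thesis by linarith
qed

end
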